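(* The category $\mathbf{SSys}$ is complete and cocomplete, and its limits and colimits are obtained by passing to $\mathcal{H}$ and then applying the simplification: for a small diagram $D$ in $\mathbf{SSys}$, a limit (resp. colimit) of $D$ is $\mathcal{S}_{\mathcal{H}}$ applied to a limit (resp. colimit) of $\mathcal{N}_{\mathcal{H}}\circ D$ in $\mathcal{H}$.
   Context: Let $\mathcal{P}:\mathbf{Set}\to\mathbf{Set}$ be the covariant power-set functor ($\mathcal{P}(g)(A)=g(A)$). $\mathcal{H}$ is the category of set-system hypergraphs, the comma category $(\mathrm{id}_{\mathbf{Set}}\downarrow\mathcal{P})$: objects are triples $(E,\epsilon,V)$ with sets $E,V$ and a function $\epsilon:E\to\mathcal{P}(V)$; morphisms $(E,\epsilon,V)\to(E',\epsilon',V')$ are pairs of functions $(\phi:E\to E',\psi:V\to V')$ with $\epsilon'\circ\phi=\mathcal{P}(\psi)\circ\epsilon$. $\mathbf{SSys}$ is the category of set systems: objects are pairs $(V,\beta)$ with $V$ a set and $\beta\subseteq\mathcal{P}(V)$; morphisms $(V,\beta)\to(V',\beta')$ are functions $g:V\to V'$ with $g(A)\in\beta'$ for all $A\in\beta$. The functor $\mathcal{N}_{\mathcal{H}}:\mathbf{SSys}\to\mathcal{H}$ sends $(V,\beta)$ to $(\beta,\iota_\beta,V)$ with $\iota_\beta$ the inclusion $\beta\hookrightarrow\mathcal{P}(V)$, and $g$ to $(\mathcal{P}(g)|_\beta,g)$. The simplification functor $\mathcal{S}_{\mathcal{H}}:\mathcal{H}\to\mathbf{SSys}$ sends $(E,\epsilon,V)$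 to $(V,\{\epsilon(e):e\in E\})$ and $(\phi,\psi)$ to $\psi$. *)

theory Defs
  imports "HOL-Library.FuncSet"
begin

section \<open>Categories, functors, limits and colimits\<close>

record ('o, 'a) cat =
  Ob :: "'o set"
  Ar :: "'a set"
  Dom :: "'a \<Rightarrow> 'o"
  Cod :: "'a \<Rightarrow> 'o"
  Id :: "'o \<Rightarrow> 'a"
  Comp :: "'a \<Rightarrow> 'a \<Rightarrow> 'a"  (* Comp C g f is g after f *)

definition is_category :: "('o, 'a) cat \<Rightarrow> bool" where
  "is_category C \<longleftrightarrow>
     (\<forall>f\<in>Ar C. Dom C f \<in> Ob C \<and> Cod C f \<in> Ob C) \<and>
     (\<forall>X\<in>Ob C. Id C X \<in> Ar C \<and> Dom C (Id C X) = X \<and> Cod C (Id C X) = X) \<and>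
     (\<forall>f\<in>Ar C. \<forall>g\<in>Ar C. Cod C f = Dom C g \<longrightarrow>
        Comp C g f \<in> Ar C \<and> Dom C (Comp C g f) = Dom C f \<and> Cod C (Comp C g f) = Cod C g) \<and>
     (\<forall>f\<in>Ar C. Comp C f (Id C (Dom C f)) = f \<and> Comp C (Id C (Cod C f)) f = f) \<and>
     (\<forall>f\<in>Ar C. \<forall>g\<in>Ar C. \<forall>h\<in>Ar C. Cod C f = Dom C g \<longrightarrow> Cod C g = Dom C h \<longrightarrow>
        Comp C h (Comp C g f) = Comp C (Comp C h g) f)"

record ('o1, 'a1, 'o2, 'a2) fctr =
  FOb :: "'o1 \<Rightarrow> 'o2"
  FAr :: "'a1 \<Rightarrow> 'a2"

definition is_functor ::
  "('o1, 'a1) cat \<Rightarrow> ('o2, 'a2) cat \<Rightarrow> ('o1, 'a1, 'o2, 'a2) fctr \<Rightarrow> bool" where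
  "is_functor C D F \<longleftrightarrow>
     is_category C \<and> is_category D \<and>
     (\<forall>X\<in>Ob C. FOb F X \<in> Ob D) \<and>
     (\<forall>f\<in>Ar C. FAr F f \<in> Ar D \<and>
        Dom D (FAr F f) = FOb F (Dom C f) \<and> Cod D (FAr F f) = FOb F (Cod C f)) \<and>
     (\<forall>X\<in>Ob C. FAr F (Id C X) = Id D (FOb F X)) \<and>
     (\<forall>f\<in>Ar C. \<forall>g\<in>Ar C. Cod C f = Dom C g \<longrightarrow>
        FAr F (Comp C g f) = Comp D (FAr F g) (FAr F f))"

definition fctr_comp ::
  "('o2, 'a2, 'o3, 'a3) fctr \<Rightarrow> ('o1, 'a1, 'o2, 'a2) fctr \<Rightarrow> ('o1, 'a1, 'o3, 'a3) fctr"
  (infixr "\<circ>\<^sub>F" 55) where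
  "G \<circ>\<^sub>F F = \<lparr>FOb = FOb G \<circ> FOb F, FAr = FAr G \<circ> FAr F\<rparr>"

definition is_cone ::
  "('j, 'k) cat \<Rightarrow> ('o, 'a) cat \<Rightarrow> ('j, 'k, 'o, 'a) fctr \<Rightarrow> 'o \<Rightarrow> ('j \<Rightarrow> 'a) \<Rightarrow> bool" where
  "is_cone J C D X p \<longleftrightarrow>
     X \<in> Ob C \<and>
     (\<forall>j\<in>Ob J. p j \<in> Ar C \<and> Dom C (p j) = X \<and> Cod C (p j) = FOb D j) \<and>
     (\<forall>u\<in>Ar J. Comp C (FAr D u) (p (Dom J u)) = p (Cod J u))"

definition is_limit ::
  "('j, 'k) cat \<Rightarrow> ('o, 'a) cat \<Rightarrow> ('j, 'k, 'o, 'a) fctr \<Rightarrow> 'o \<Rightarrow> ('j \<Rightarrow> 'a) \<Rightarrow> bool" where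
  "is_limit J C D L p \<longleftrightarrow>
     is_cone J C D L p \<and>
     (\<forall>X q. is_cone J C D X q \<longrightarrow>
        (\<exists>!h. h \<in> Ar C \<and> Dom C h = X \<and> Cod C h = L \<and> (\<forall>j\<in>Ob J. Comp C (p j) h = q j)))"

definition is_cocone ::
  "('j, 'k) cat \<Rightarrow> ('o, 'a) cat \<Rightarrow> ('j, 'k, 'o, 'a) fctr \<Rightarrow> 'o \<Rightarrow> ('j \<Rightarrow> 'a) \<Rightarrow> bool" where
  "is_cocone J C D X i \<longleftrightarrow>
     X \<in> Ob C \<and>
     (\<forall>j\<in>Ob J. i j \<in> Ar C \<and> Dom C (i j) = FOb D j \<and> Cod C (i j) = X) \<and>
     (\<forall>u\<in>Ar J. Comp C (i (Cod J u)) (FAr D u) = i (Dom J u))"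

definition is_colimit ::
  "('j, 'k) cat \<Rightarrow> ('o, 'a) cat \<Rightarrow> ('j, 'k, 'o, 'a) fctr \<Rightarrow> 'o \<Rightarrow> ('j \<Rightarrow> 'a) \<Rightarrow> bool" where
  "is_colimit J C D L i \<longleftrightarrow>
     is_cocone J C D L i \<and>
     (\<forall>X q. is_cocone J C D X q \<longrightarrow>
        (\<exists>!h. h \<in> Ar C \<and> Dom C h = L \<and> Cod C h = X \<and> (\<forall>j\<in>Ob J. Comp C h (i j) = q j)))"

section \<open>The universe of sets\<close>

text \<open>
  No type of HOL contains all sets, so sets are the elements of a type with a membership
  structure satisfying extensionality, separation, union, power set and (second-order) replacement;
  \<open>elts x\<close> is the collection of the members of \<open>x\<close>. A collection is small if it is
  \<open>elts x\<close> for some \<open>x\<close>. Any Grothendieck universe, with its membership relation, is an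
  instance. Infinity and foundation are not assumed, so the hereditarily finite sets are an
  instance as well (lemma \<open>set_universe_hf\<close> below); the usual category of sets is the case where
  infinity and foundation hold too.
\<close>

class set_universe =
  fixes elts :: "'a \<Rightarrow> 'a set"
  assumes elts_ext: "elts x = elts y \<Longrightarrow> x = y"
    and elts_separation: "X \<subseteq> elts x \<Longrightarrow> X \<in> range elts"
    and elts_union: "(\<Union>y\<in>elts x. elts y) \<in> range elts"
    and elts_power: "{y. elts y \<subseteq> elts x} \<in> range elts"
    and elts_replacement: "f ` elts x \<in> range elts"

definition small :: "'u::set_universe set \<Rightarrow> bool" where
  "small X \<longleftrightarrow> X \<in> range elts"

(* the set with a given small collection of members; a junk value if the collection is not small *)
definition set_of :: "'u::set_universe set \<Rightarrow> 'u" where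
  "set_of X = inv elts X"

definition pow :: "'u::set_universe \<Rightarrow> 'u" where
  "pow V = set_of {A. elts A \<subseteq> elts V}"

(* the action g(A) of the power-set functor on a function g *)
definition img :: "('u::set_universe \<Rightarrow> 'u) \<Rightarrow> 'u \<Rightarrow> 'u" where
  "img g A = set_of (g ` elts A)"

definition small_category :: "('u::set_universe, 'u) cat \<Rightarrow> bool" where
  "small_category J \<longleftrightarrow> is_category J \<and> small (Ob J) \<and> small (Ar J)"

text \<open>
  The universe is passed as a type argument, because it is not determined by the types of
  objects and arrows of an arbitrary \<open>C\<close>.
\<close>

definition complete :: "'u::set_universe itself \<Rightarrow> ('o, 'a) cat \<Rightarrow> bool" where
  "complete U C \<longleftrightarrow>
     (\<forall>(J :: ('u, 'u) cat) D. small_category J \<and> is_functor J C D \<longrightarrow>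
        (\<exists>L p. is_limit J C D L p))"

definition cocomplete :: "'u::set_universe itself \<Rightarrow> ('o, 'a) cat \<Rightarrow> bool" where
  "cocomplete U C \<longleftrightarrow>
     (\<forall>(J :: ('u, 'u) cat) D. small_category J \<and> is_functor J C D \<longrightarrow>
        (\<exists>L i. is_colimit J C D L i))"

section \<open>Set-system hypergraphs\<close>

text \<open>
  A function from \<open>A\<close> to \<open>B\<close> is an element of \<open>elts A \<rightarrow>\<^sub>E elts B\<close>, i.e. it has the
  value \<open>undefined\<close> outside \<open>A\<close>; this makes equality of arrows equality of functions on \<open>A\<close>.
\<close>

datatype 'u hypergraph = Hypergraph (edges: 'u) (inc: "'u \<Rightarrow> 'u") (verts: 'u)

definition is_hypergraph :: "'u::set_universe hypergraph \<Rightarrow> bool" where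
  "is_hypergraph G \<longleftrightarrow> inc G \<in> elts (edges G) \<rightarrow>\<^sub>E elts (pow (verts G))"

datatype 'u hyp_mor =
  HypMor (hsrc: "'u hypergraph") (htgt: "'u hypergraph") (emap: "'u \<Rightarrow> 'u") (vmap: "'u \<Rightarrow> 'u")

definition is_hyp_mor :: "'u::set_universe hyp_mor \<Rightarrow> bool" where
  "is_hyp_mor f \<longleftrightarrow>
     is_hypergraph (hsrc f) \<and> is_hypergraph (htgt f) \<and>
     emap f \<in> elts (edges (hsrc f)) \<rightarrow>\<^sub>E elts (edges (htgt f)) \<and>
     vmap f \<in> elts (verts (hsrc f)) \<rightarrow>\<^sub>E elts (verts (htgt f)) \<and>
     (\<forall>e\<in>elts (edges (hsrc f)). inc (htgt f) (emap f e) = img (vmap f) (inc (hsrc f) e))"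

definition Hyp :: "('u::set_universe hypergraph, 'u hyp_mor) cat" where
  "Hyp = \<lparr>Ob = {G. is_hypergraph G}, Ar = {f. is_hyp_mor f}, Dom = hsrc, Cod = htgt,
     Id = (\<lambda>G. HypMor G G (\<lambda>e\<in>elts (edges G). e) (\<lambda>v\<in>elts (verts G). v)),
     Comp = (\<lambda>g f. HypMor (hsrc f) (htgt g)
        (compose (elts (edges (hsrc f))) (emap g) (emap f))
        (compose (elts (verts (hsrc f))) (vmap g) (vmap f)))\<rparr>"

section \<open>Set systems\<close>

datatype 'u set_system = SetSystem (points: 'u) (family: 'u)

definition is_set_system :: "'u::set_universe set_system \<Rightarrow> bool" where
  "is_set_system X \<longleftrightarrow> elts (family X) \<subseteq> elts (pow (points X))"

datatype 'u ssys_mor =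
  SSysMor (ssrc: "'u set_system") (stgt: "'u set_system") (smap: "'u \<Rightarrow> 'u")

definition is_ssys_mor :: "'u::set_universe ssys_mor \<Rightarrow> bool" where
  "is_ssys_mor g \<longleftrightarrow>
     is_set_system (ssrc g) \<and> is_set_system (stgt g) \<and>
     smap g \<in> elts (points (ssrc g)) \<rightarrow>\<^sub>E elts (points (stgt g)) \<and>
     (\<forall>A\<in>elts (family (ssrc g)). img (smap g) A \<in> elts (family (stgt g)))"

definition SSys :: "('u::set_universe set_system, 'u ssys_mor) cat" where
  "SSys = \<lparr>Ob = {X. is_set_system X}, Ar = {g. is_ssys_mor g}, Dom = ssrc, Cod = stgt,
     Id = (\<lambda>X. SSysMor X X (\<lambda>v\<in>elts (points X). v)),
     Comp = (\<lambda>g f. SSysMor (ssrc f) (stgt g)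
        (compose (elts (points (ssrc f))) (smap g) (smap f)))\<rparr>"

section \<open>The functors between them\<close>

definition N_ob :: "'u::set_universe set_system \<Rightarrow> 'u hypergraph" where
  "N_ob X = Hypergraph (family X) (\<lambda>A\<in>elts (family X). A) (points X)"

definition N_H :: "('u::set_universe set_system, 'u ssys_mor, 'u hypergraph, 'u hyp_mor) fctr" where
  "N_H = \<lparr>FOb = N_ob,
     FAr = (\<lambda>g. HypMor (N_ob (ssrc g)) (N_ob (stgt g))
        (\<lambda>A\<in>elts (family (ssrc g)). img (smap g) A) (smap g))\<rparr>"

definition S_ob :: "'u::set_universe hypergraph \<Rightarrow> 'u set_system" where
  "S_ob G = SetSystem (verts G) (set_of (inc G ` elts (edges G)))"

definition S_H :: "('u::set_universe hypergraph, 'u hyp_mor, 'u set_system, 'u ssys_mor) fctr" where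
  "S_H = \<lparr>FOb = S_ob, FAr = (\<lambda>f. SSysMor (S_ob (hsrc f)) (S_ob (htgt f)) (vmap f))\<rparr>"

section \<open>Well-definedness\<close>

lemma set_universe_hf: "class.set_universe (\<lambda>n::nat. {k. bit n k})"
proof -
  let ?e = "\<lambda>n::nat. {k. bit n k}"
  have fin: "finite (?e n)" for n
  proof (rule finite_subset)
    show "?e n \<subseteq> {..n}"
      by (auto simp: bit_iff_odd)
        (metis div_less even_zero less_exp less_trans not_le)
  qed simp
  have inj: "x = y" if "?e x = ?e y" for x y
    using that by (auto intro!: bit_eqI)
  have ex: "\<exists>n. X = ?e n" if "finite X" for X
    using that
  proof (induction X)
    case empty
    have "{} = ?e 0" by simp
    then show ?case ..
  next
    case (insert k X)
    then obtain n where "X = ?e n" by blast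
    then have "insert k X = ?e (set_bit k n)"
      by (auto simp: bit_set_bit_iff possible_bit_def)
    then show ?case ..
  qed
  have ran: "X \<in> range ?e" if "finite X" for X
    using ex[OF that] by blast
  show ?thesis
  proof
    show "{y. ?e y \<subseteq> ?e x} \<in> range ?e" for x
    proof (rule ran, rule finite_imageD)
      show "finite (?e ` {y. ?e y \<subseteq> ?e x})"
        by (rule finite_subset[of _ "Pow (?e x)"]) (auto simp: fin)
      show "inj_on ?e {y. ?e y \<subseteq> ?e x}" by (rule inj_onI) (rule inj)
    qed
  qed (rule inj ran, assumption | rule ran finite_UN_I finite_imageI fin | erule finite_subset)+
qed

lemma elts_set_of: "small X \<Longrightarrow> elts (set_of X) = X"
  unfolding small_def set_of_def by (rule f_inv_into_f)

lemma set_of_elts [simp]: "set_of (elts x) = x"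
  unfolding set_of_def by (rule inv_f_f) (auto intro: injI elts_ext)

lemma elts_pow [simp]: "elts (pow V) = {A. elts A \<subseteq> elts V}"
  unfolding pow_def by (rule elts_set_of) (simp add: small_def elts_power)

lemma elts_img [simp]: "elts (img g A) = g ` elts A"
  unfolding img_def by (rule elts_set_of) (simp add: small_def elts_replacement)

lemma family_S_ob [simp]: "elts (family (S_ob G)) = inc G ` elts (edges G)"
  unfolding S_ob_def by (simp add: elts_set_of small_def elts_replacement)

lemma points_S_ob [simp]: "points (S_ob G) = verts G"
  by (simp add: S_ob_def)

lemma img_compose: "elts A \<subseteq> elts V \<Longrightarrow> img (compose (elts V) g f) A = img g (img f A)"
  by (rule elts_ext) (auto simp: compose_def image_image intro!: image_cong)

lemma img_id: "elts A \<subseteq> elts V \<Longrightarrow> img (\<lambda>v\<in>elts V. v) A = A"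
  by (rule elts_ext) force

lemma hyp_mor_eqI:
  "hsrc f = hsrc g \<Longrightarrow> htgt f = htgt g \<Longrightarrow> emap f = emap g \<Longrightarrow> vmap f = vmap g \<Longrightarrow> f = g"
  by (cases f; cases g) simp

lemma ssys_mor_eqI: "ssrc f = ssrc g \<Longrightarrow> stgt f = stgt g \<Longrightarrow> smap f = smap g \<Longrightarrow> f = g"
  by (cases f; cases g) simp

lemma inc_sub: "is_hypergraph G \<Longrightarrow> e \<in> elts (edges G) \<Longrightarrow> elts (inc G e) \<subseteq> elts (verts G)"
  unfolding is_hypergraph_def by (drule PiE_mem) auto

lemma family_sub: "is_set_system X \<Longrightarrow> A \<in> elts (family X) \<Longrightarrow> elts A \<subseteq> elts (points X)"
  unfolding is_set_system_def by auto

lemma compose_id_right: "f \<in> A \<rightarrow>\<^sub>E B \<Longrightarrow> compose A f (\<lambda>x\<in>A. x) = f"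
  by (auto simp: compose_def fun_eq_iff PiE_def extensional_def)

lemma compose_id_left: "f \<in> A \<rightarrow>\<^sub>E B \<Longrightarrow> compose A (\<lambda>x\<in>B. x) f = f"
  by (auto simp: compose_def fun_eq_iff PiE_def extensional_def Pi_def)

lemma compose_PiE: "f \<in> A \<rightarrow>\<^sub>E B \<Longrightarrow> g \<in> B \<rightarrow>\<^sub>E C \<Longrightarrow> compose A g f \<in> A \<rightarrow>\<^sub>E C"
  by (auto simp: compose_def PiE_def Pi_def)

lemma compose_assoc_PiE: "f \<in> A \<rightarrow>\<^sub>E B \<Longrightarrow> compose A h (compose A g f) = compose A (compose B h g) f"
  by (auto simp: compose_def PiE_def Pi_def fun_eq_iff)

lemma is_hyp_mor_id:
  "is_hypergraph G \<Longrightarrow> is_hyp_mor (HypMor G G (\<lambda>e\<in>elts (edges G). e) (\<lambda>v\<in>elts (verts G). v))"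
  by (auto simp: is_hyp_mor_def img_id inc_sub)

lemma is_hyp_mor_comp:
  assumes f: "is_hyp_mor f" and g: "is_hyp_mor g" and fg: "htgt f = hsrc g"
  shows "is_hyp_mor (HypMor (hsrc f) (htgt g)
    (compose (elts (edges (hsrc f))) (emap g) (emap f))
    (compose (elts (verts (hsrc f))) (vmap g) (vmap f)))"
proof -
  have "inc (htgt g) (emap g (emap f e)) = img (vmap g) (img (vmap f) (inc (hsrc f) e))"
    if "e \<in> elts (edges (hsrc f))" for e
  proof -
    have "emap f e \<in> elts (edges (hsrc g))"
      using f that fg unfolding is_hyp_mor_def by (metis PiE_mem)
    then show ?thesis using f g that fg unfolding is_hyp_mor_def by metis
  qed
  moreover have "compose (elts (edges (hsrc f))) (emap g) (emap f)
      \<in> elts (edges (hsrc f)) \<rightarrow>\<^sub>E elts (edges (htgt g))"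
    "compose (elts (verts (hsrc f))) (vmap g) (vmap f)
      \<in> elts (verts (hsrc f)) \<rightarrow>\<^sub>E elts (verts (htgt g))"
    using f g fg unfolding is_hyp_mor_def by (metis compose_PiE)+
  ultimately show ?thesis
    using f g fg unfolding is_hyp_mor_def by (simp add: img_compose inc_sub compose_eq)
qed

lemma is_category_Hyp: "is_category (Hyp :: ('u::set_universe hypergraph, 'u hyp_mor) cat)"
proof -
  have "is_hypergraph (hsrc f)" "is_hypergraph (htgt f)"
    "emap f \<in> elts (edges (hsrc f)) \<rightarrow>\<^sub>E elts (edges (htgt f))"
    "vmap f \<in> elts (verts (hsrc f)) \<rightarrow>\<^sub>E elts (verts (htgt f))" if "is_hyp_mor f" for f :: "'u hyp_mor"
    using that by (auto simp: is_hyp_mor_def)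
  note m = this
  show ?thesis
    unfolding is_category_def Hyp_def
    by (auto simp: m is_hyp_mor_id is_hyp_mor_comp compose_id_right[OF m(3)] compose_id_right[OF m(4)]
        compose_id_left[OF m(3)] compose_id_left[OF m(4)]
        intro!: hyp_mor_eqI)
      (metis compose_assoc_PiE m(3) m(4))+
qed

lemma is_ssys_mor_id: "is_set_system X \<Longrightarrow> is_ssys_mor (SSysMor X X (\<lambda>v\<in>elts (points X). v))"
  by (auto simp: is_ssys_mor_def img_id family_sub)

lemma is_ssys_mor_comp:
  assumes f: "is_ssys_mor f" and g: "is_ssys_mor g" and fg: "stgt f = ssrc g"
  shows "is_ssys_mor (SSysMor (ssrc f) (stgt g)
    (compose (elts (points (ssrc f))) (smap g) (smap f)))"
proof -
  have "compose (elts (points (ssrc f))) (smap g) (smap f)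
      \<in> elts (points (ssrc f)) \<rightarrow>\<^sub>E elts (points (stgt g))"
    using f g fg unfolding is_ssys_mor_def by (metis compose_PiE)
  then show ?thesis
    using f g fg unfolding is_ssys_mor_def by (simp add: img_compose family_sub)
qed

lemma is_category_SSys: "is_category (SSys :: ('u::set_universe set_system, 'u ssys_mor) cat)"
proof -
  have "is_set_system (ssrc f)" "is_set_system (stgt f)"
    "smap f \<in> elts (points (ssrc f)) \<rightarrow>\<^sub>E elts (points (stgt f))" if "is_ssys_mor f" for f :: "'u ssys_mor"
    using that by (auto simp: is_ssys_mor_def)
  note m = this
  show ?thesis
    unfolding is_category_def SSys_def
    by (auto simp: m is_ssys_mor_id is_ssys_mor_comp compose_id_right[OF m(3)]
        compose_id_left[OF m(3)] intro!: ssys_mor_eqI)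
      (metis compose_assoc_PiE m(3))+
qed

lemma is_hypergraph_N_ob: "is_set_system X \<Longrightarrow> is_hypergraph (N_ob X)"
  by (auto simp: is_hypergraph_def N_ob_def is_set_system_def)

lemma is_set_system_S_ob: "is_hypergraph G \<Longrightarrow> is_set_system (S_ob G)"
  using inc_sub by (auto simp: is_set_system_def)

lemma is_functor_N_H:
  "is_functor (SSys :: ('u::set_universe set_system, 'u ssys_mor) cat) Hyp N_H"
proof -
  have "is_hyp_mor (FAr N_H g)" if "is_ssys_mor g" for g :: "'u ssys_mor"
    using that is_hypergraph_N_ob unfolding is_ssys_mor_def is_hyp_mor_def N_H_def
    by (auto simp: N_ob_def)
  moreover have "FAr N_H (Id SSys X) = Id Hyp (FOb N_H X)" if "is_set_system X" for X :: "'u set_system"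
    using that by (auto simp: SSys_def Hyp_def N_H_def N_ob_def img_id family_sub intro!: restrict_ext)
  moreover have "FAr N_H (Comp SSys g f) = Comp Hyp (FAr N_H g) (FAr N_H f)"
    if "is_ssys_mor f" "is_ssys_mor g" "stgt f = ssrc g" for f g :: "'u ssys_mor"
    using that by (auto simp: SSys_def Hyp_def N_H_def N_ob_def is_ssys_mor_def img_compose family_sub
        compose_def[of "elts (family _)"] intro!: restrict_ext)
  ultimately show ?thesis
    unfolding is_functor_def using is_category_SSys is_category_Hyp
    by (simp add: SSys_def Hyp_def is_hypergraph_N_ob) (simp add: N_H_def is_hypergraph_N_ob)
qed

lemma is_functor_S_H:
  "is_functor (Hyp :: ('u::set_universe hypergraph, 'u hyp_mor) cat) SSys S_H"
proof -
  have "is_ssys_mor (FAr S_H f)" if "is_hyp_mor f" for f :: "'u hyp_mor"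
    using that is_set_system_S_ob unfolding is_ssys_mor_def is_hyp_mor_def S_H_def
    by (auto simp: image_iff) (metis PiE_mem)
  then show ?thesis
    unfolding is_functor_def using is_category_SSys is_category_Hyp
    by (auto simp: SSys_def Hyp_def S_H_def is_set_system_S_ob)
qed

text \<open>
  Since \<open>S_H \<circ>\<^sub>F N_H\<close> is the identity on the nose, applying \<open>S_H\<close> to a cone over
  \<open>N_H \<circ>\<^sub>F D\<close> gives a cone over \<open>D\<close> itself.
\<close>

lemma S_N_ob: "FOb S_H (FOb N_H X) = X"
  by (cases X) (simp add: S_H_def N_H_def S_ob_def N_ob_def)

lemma S_N_ar: "FAr S_H (FAr N_H g) = g"
  by (cases g) (simp add: S_H_def N_H_def S_ob_def N_ob_def)

end

theory Submission
  imports Defs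
begin

text \<open>
  \<open>N_H\<close> is a fully faithful right adjoint of \<open>S_H\<close>, with strict identity \<open>S_H \<circ>\<^sub>F N_H = Id\<close> as
  counit. For such a reflection, \<open>S_H\<close> sends colimits of \<open>N_H \<circ>\<^sub>F D\<close> to colimits of \<open>D\<close>
  because it is a left adjoint, and limits of \<open>N_H \<circ>\<^sub>F D\<close> to limits of \<open>D\<close> because the unit is
  invertible at such a limit up to a map that \<open>S_H\<close> sends to an identity. It therefore suffices to
  construct limits in \<open>SSys\<close>, which \<open>N_H\<close> preserves, and colimits in \<open>Hyp\<close>. The limit of set
  systems carries the largest family that every projection maps into the given families; the
  colimit of hypergraphs is computed separately on edges and on vertices.
\<close>

section \<open>Formal theory of an adjunction whose counit is the identity\<close>

section \<open>Strict reflections\<close>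

text \<open>The unit laws take the object as a separate variable \<open>X\<close>, so that they
  rewrite when it agrees with the domain or codomain only up to a provable equation.\<close>

lemma category_simps:
  assumes "is_category C"
  shows "f \<in> Ar C \<Longrightarrow> Dom C f \<in> Ob C" "f \<in> Ar C \<Longrightarrow> Cod C f \<in> Ob C"
    "X \<in> Ob C \<Longrightarrow> Id C X \<in> Ar C" "X \<in> Ob C \<Longrightarrow> Dom C (Id C X) = X" "X \<in> Ob C \<Longrightarrow> Cod C (Id C X) = X"
    "f \<in> Ar C \<Longrightarrow> g \<in> Ar C \<Longrightarrow> Cod C f = Dom C g \<Longrightarrow> Comp C g f \<in> Ar C"
    "f \<in> Ar C \<Longrightarrow> g \<in> Ar C \<Longrightarrow> Cod C f = Dom C g \<Longrightarrow> Dom C (Comp C g f) = Dom C f"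
    "f \<in> Ar C \<Longrightarrow> g \<in> Ar C \<Longrightarrow> Cod C f = Dom C g \<Longrightarrow> Cod C (Comp C g f) = Cod C g"
    "f \<in> Ar C \<Longrightarrow> Dom C f = X \<Longrightarrow> Comp C f (Id C X) = f"
    "f \<in> Ar C \<Longrightarrow> Cod C f = X \<Longrightarrow> Comp C (Id C X) f = f"
  using assms by (auto simp: is_category_def)

lemma category_assoc:
  assumes "is_category C" "f \<in> Ar C" "g \<in> Ar C" "h \<in> Ar C" "Cod C f = Dom C g" "Cod C g = Dom C h"
  shows "Comp C (Comp C h g) f = Comp C h (Comp C g f)"
  using assms by (auto simp: is_category_def)

lemma functor_simps:
  assumes "is_functor C D F"
  shows "X \<in> Ob C \<Longrightarrow> FOb F X \<in> Ob D" "f \<in> Ar C \<Longrightarrow> FAr F f \<in> Ar D"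
    "f \<in> Ar C \<Longrightarrow> Dom D (FAr F f) = FOb F (Dom C f)" "f \<in> Ar C \<Longrightarrow> Cod D (FAr F f) = FOb F (Cod C f)"
    "X \<in> Ob C \<Longrightarrow> FAr F (Id C X) = Id D (FOb F X)"
    "f \<in> Ar C \<Longrightarrow> g \<in> Ar C \<Longrightarrow> Cod C f = Dom C g \<Longrightarrow> FAr F (Comp C g f) = Comp D (FAr F g) (FAr F f)"
    "is_category C" "is_category D"
  using assms by (auto simp: is_functor_def)

lemma functor_comp:
  assumes "is_functor C D F" "is_functor D E G"
  shows "is_functor C E (G \<circ>\<^sub>F F)"
  using assms unfolding is_functor_def fctr_comp_def by auto

lemma functor_cone:
  assumes D: "is_functor J C D" and F: "is_functor C E F" and q: "is_cone J C D X q"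
  shows "is_cone J E (F \<circ>\<^sub>F D) (FOb F X) (\<lambda>j. FAr F (q j))"
proof -
  have "Comp E (FAr F (FAr D u)) (FAr F (q (Dom J u))) = FAr F (q (Cod J u))" if "u \<in> Ar J" for u
  proof -
    have "Dom J u \<in> Ob J" using that D functor_simps(7)[OF D] by (simp add: category_simps)
    then show ?thesis
      using q that functor_simps[OF D] unfolding is_cone_def
      by (subst functor_simps(6)[OF F, symmetric]) auto
  qed
  then show ?thesis
    using q unfolding is_cone_def by (simp add: fctr_comp_def functor_simps[OF F])
qed

lemma functor_cocone:
  assumes D: "is_functor J C D" and F: "is_functor C E F" and q: "is_cocone J C D X q"
  shows "is_cocone J E (F \<circ>\<^sub>F D) (FOb F X) (\<lambda>j. FAr F (q j))"
proof -
  have "Comp E (FAr F (q (Cod J u))) (FAr F (FAr D u)) = FAr F (q (Dom J u))" if "u \<in> Ar J" for u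
  proof -
    have "Cod J u \<in> Ob J" using that D functor_simps(7)[OF D] by (simp add: category_simps)
    then show ?thesis
      using q that functor_simps[OF D] unfolding is_cocone_def
      by (subst functor_simps(6)[OF F, symmetric]) auto
  qed
  then show ?thesis
    using q unfolding is_cocone_def by (simp add: fctr_comp_def functor_simps[OF F])
qed

text \<open>\<open>S\<close> is left adjoint to \<open>N\<close>, with identity counit;
  \<open>S_unit\<close> and \<open>unit_N\<close> are then the triangle identities. For an arrow
  \<open>k\<close> between values of \<open>N\<close>, naturality and \<open>unit_N\<close> give
  \<open>k = FAr N (FAr S k)\<close>, which together with \<open>SN_ar\<close> makes
  \<open>N\<close> fully faithful.\<close>

locale strict_reflection =
  fixes C :: "('o, 'a) cat" and H :: "('p, 'b) cat" and N S and unit :: "'p \<Rightarrow> 'b"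
  assumes N: "is_functor C H N" and S: "is_functor H C S"
    and SN_ob: "X \<in> Ob C \<Longrightarrow> FOb S (FOb N X) = X"
    and SN_ar: "f \<in> Ar C \<Longrightarrow> FAr S (FAr N f) = f"
    and unit_ar: "G \<in> Ob H \<Longrightarrow> unit G \<in> Ar H"
    and unit_dom: "G \<in> Ob H \<Longrightarrow> Dom H (unit G) = G"
    and unit_cod: "G \<in> Ob H \<Longrightarrow> Cod H (unit G) = FOb N (FOb S G)"
    and unit_natural: "g \<in> Ar H \<Longrightarrow>
      Comp H (unit (Cod H g)) g = Comp H (FAr N (FAr S g)) (unit (Dom H g))"
    and S_unit: "G \<in> Ob H \<Longrightarrow> FAr S (unit G) = Id C (FOb S G)"
    and unit_N: "X \<in> Ob C \<Longrightarrow> unit (FOb N X) = Id H (FOb N X)"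
begin

lemmas categories = functor_simps(7,8)[OF N]
lemmas simps = functor_simps(1-5)[OF N] functor_simps(1-5)[OF S] SN_ob SN_ar
  unit_ar unit_dom unit_cod S_unit unit_N
  category_simps[OF categories(1)] category_simps[OF categories(2)]
lemmas N_comp = functor_simps(6)[OF N] and S_comp = functor_simps(6)[OF S]

text \<open>On objects and arrows of \<open>J\<close>, the diagram
  \<open>S \<circ>\<^sub>F N \<circ>\<^sub>F D\<close> has the same values as \<open>D\<close>, so
  the image cone needs no transport along an isomorphism.\<close>

lemma S_cone:
  assumes D: "is_functor J C D" and q: "is_cone J H (N \<circ>\<^sub>F D) G q"
  shows "is_cone J C D (FOb S G) (\<lambda>j. FAr S (q j))"
proof -
  have "is_cone J C (S \<circ>\<^sub>F (N \<circ>\<^sub>F D)) (FOb S G) (\<lambda>j. FAr S (q j))"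
    by (rule functor_cone[OF functor_comp[OF D N] S q])
  then show ?thesis
    by (simp add: is_cone_def fctr_comp_def functor_simps[OF D] simps)
qed

lemma S_cocone:
  assumes D: "is_functor J C D" and q: "is_cocone J H (N \<circ>\<^sub>F D) G q"
  shows "is_cocone J C D (FOb S G) (\<lambda>j. FAr S (q j))"
proof -
  have "is_cocone J C (S \<circ>\<^sub>F (N \<circ>\<^sub>F D)) (FOb S G) (\<lambda>j. FAr S (q j))"
    by (rule functor_cocone[OF functor_comp[OF D N] S q])
  then show ?thesis
    by (simp add: is_cocone_def fctr_comp_def functor_simps[OF D] simps)
qed

text \<open>Right adjoints preserve limits: a cone \<open>q\<close> from \<open>G\<close> transposes
  to \<open>FAr S (q j)\<close>, and the mediating map \<open>h\<close> found in \<open>C\<close>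
  transposes back to \<open>Comp H (FAr N h) (unit G)\<close>.\<close>

lemma N_limit:
  assumes D: "is_functor J C D" and L: "is_limit J C D L p"
  shows "is_limit J H (N \<circ>\<^sub>F D) (FOb N L) (\<lambda>j. FAr N (p j))"
  unfolding is_limit_def
proof (intro conjI allI impI)
  have p: "is_cone J C D L p" using L by (simp add: is_limit_def)
  then have LO: "L \<in> Ob C"
    and pj: "\<And>j. j \<in> Ob J \<Longrightarrow> p j \<in> Ar C \<and> Dom C (p j) = L \<and> Cod C (p j) = FOb D j"
    by (auto simp: is_cone_def)
  show "is_cone J H (N \<circ>\<^sub>F D) (FOb N L) (\<lambda>j. FAr N (p j))"
    by (rule functor_cone[OF D N p])
  fix G q assume q: "is_cone J H (N \<circ>\<^sub>F D) G q"
  then have GO: "G \<in> Ob H"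
    and qj: "\<And>j. j \<in> Ob J \<Longrightarrow> q j \<in> Ar H \<and> Dom H (q j) = G \<and> Cod H (q j) = FOb N (FOb D j)"
    by (auto simp: is_cone_def fctr_comp_def)
  have Sq: "is_cone J C D (FOb S G) (\<lambda>j. FAr S (q j))" by (rule S_cone[OF D q])
  obtain h where h: "h \<in> Ar C" "Dom C h = FOb S G" "Cod C h = L"
      "\<And>j. j \<in> Ob J \<Longrightarrow> Comp C (p j) h = FAr S (q j)"
    using L Sq unfolding is_limit_def by metis
  have uniq: "k = h" if "k \<in> Ar C" "Dom C k = FOb S G" "Cod C k = L"
      "\<And>j. j \<in> Ob J \<Longrightarrow> Comp C (p j) k = FAr S (q j)" for k
    using L Sq that h unfolding is_limit_def by metis
  show "\<exists>!k. k \<in> Ar H \<and> Dom H k = G \<and> Cod H k = FOb N L \<and>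
      (\<forall>j\<in>Ob J. Comp H (FAr N (p j)) k = q j)"
  proof (rule ex1I)
    have "Comp H (FAr N (p j)) (Comp H (FAr N h) (unit G)) = q j" if "j \<in> Ob J" for j
    proof -
      have "Comp H (FAr N (p j)) (Comp H (FAr N h) (unit G)) = Comp H (FAr N (FAr S (q j))) (unit G)"
        using that pj[OF that] h GO
        by (subst category_assoc[OF categories(2), symmetric]) (simp_all add: simps N_comp[symmetric])
      also have "\<dots> = Comp H (unit (FOb N (FOb D j))) (q j)"
        using unit_natural[of "q j"] qj[OF that] by simp
      also have "\<dots> = q j"
        using qj[OF that] functor_simps(1)[OF D that] by (simp add: simps)
      finally show ?thesis .
    qed
    then show "Comp H (FAr N h) (unit G) \<in> Ar H \<and> Dom H (Comp H (FAr N h) (unit G)) = G \<and>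
        Cod H (Comp H (FAr N h) (unit G)) = FOb N L \<and>
        (\<forall>j\<in>Ob J. Comp H (FAr N (p j)) (Comp H (FAr N h) (unit G)) = q j)"
      using h GO by (simp add: simps)
  next
    fix k assume k: "k \<in> Ar H \<and> Dom H k = G \<and> Cod H k = FOb N L \<and>
      (\<forall>j\<in>Ob J. Comp H (FAr N (p j)) k = q j)"
    \<comment> \<open>Uniqueness is checked on transposes; naturality recovers \<open>k\<close> from
      \<open>FAr S k\<close>, as the unit at \<open>FOb N L\<close> is an identity.\<close>
    have "FAr S k = h"
    proof (rule uniq)
      show "Comp C (p j) (FAr S k) = FAr S (q j)" if "j \<in> Ob J" for j
        using S_comp[of k "FAr N (p j)"] k that pj[OF that] by (simp add: simps)
    qed (use k LO in \<open>simp_all add: simps\<close>)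
    then show "k = Comp H (FAr N h) (unit G)"
      using unit_natural[of k] k LO by (simp add: simps)
  qed
qed

text \<open>Although \<open>L\<close> need not be a value of \<open>N\<close>, its unit has a
  retraction \<open>r\<close> that \<open>S\<close> sends to an identity. A map \<open>k\<close>
  into \<open>FOb S L\<close> is therefore \<open>FAr S\<close> of the map
  \<open>Comp H r (FAr N k)\<close> into \<open>L\<close>, and the universal property of
  \<open>L\<close> decides existence and uniqueness.\<close>

lemma S_limit:
  assumes D: "is_functor J C D" and L: "is_limit J H (N \<circ>\<^sub>F D) L p"
  shows "is_limit J C D (FOb S L) (\<lambda>j. FAr S (p j))"
  unfolding is_limit_def
proof (intro conjI allI impI)
  have p: "is_cone J H (N \<circ>\<^sub>F D) L p" using L by (simp add: is_limit_def)
  then have LO: "L \<in> Ob H"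
    and pj: "\<And>j. j \<in> Ob J \<Longrightarrow> p j \<in> Ar H \<and> Dom H (p j) = L \<and> Cod H (p j) = FOb N (FOb D j)"
    by (auto simp: is_cone_def fctr_comp_def)
  have uniq: "h = k" if "is_cone J H (N \<circ>\<^sub>F D) X q"
      "h \<in> Ar H" "Dom H h = X" "Cod H h = L" "\<And>j. j \<in> Ob J \<Longrightarrow> Comp H (p j) h = q j"
      "k \<in> Ar H" "Dom H k = X" "Cod H k = L" "\<And>j. j \<in> Ob J \<Longrightarrow> Comp H (p j) k = q j" for X q h k
    using L that unfolding is_limit_def by metis
  show Sp: "is_cone J C D (FOb S L) (\<lambda>j. FAr S (p j))" by (rule S_cone[OF D p])
  note NSp = functor_cone[OF D N Sp]
  \<comment> \<open>\<open>r\<close> mediates the cone obtained by applying \<open>S\<close> and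
    then \<open>N\<close> to \<open>p\<close>.\<close>
  obtain r where r: "r \<in> Ar H" "Dom H r = FOb N (FOb S L)" "Cod H r = L"
      "\<And>j. j \<in> Ob J \<Longrightarrow> Comp H (p j) r = FAr N (FAr S (p j))"
    using L NSp unfolding is_limit_def by metis
  have "Comp H r (unit L) = Id H L"
  proof (rule uniq[OF p])
    show "Comp H (p j) (Comp H r (unit L)) = p j" if "j \<in> Ob J" for j
    proof -
      have "Comp H (p j) (Comp H r (unit L)) = Comp H (FAr N (FAr S (p j))) (unit L)"
        using pj[OF that] r that LO
        by (subst category_assoc[OF categories(2), symmetric]) (simp_all add: simps)
      also have "\<dots> = Comp H (unit (FOb N (FOb D j))) (p j)"
        using unit_natural[of "p j"] pj[OF that] by simp
      also have "\<dots> = p j"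
        using pj[OF that] functor_simps(1)[OF D that] by (simp add: simps)
      finally show ?thesis .
    qed
  qed (use r LO pj in \<open>simp_all add: simps\<close>)
  then have "Comp C (FAr S r) (FAr S (unit L)) = Id C (FOb S L)"
    using r LO by (subst S_comp[symmetric]) (simp_all add: simps)
  \<comment> \<open>\<open>S\<close> sends the unit to an identity, so the retraction equation
    leaves only \<open>FAr S r\<close>.\<close>
  then have Sr: "FAr S r = Id C (FOb S L)"
    using r LO by (simp add: simps)
  fix X q assume q: "is_cone J C D X q"
  then have XO: "X \<in> Ob C" by (auto simp: is_cone_def)
  note Nq = functor_cone[OF D N q]
  obtain h where h: "h \<in> Ar H" "Dom H h = FOb N X" "Cod H h = L"
      "\<And>j. j \<in> Ob J \<Longrightarrow> Comp H (p j) h = FAr N (q j)"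
    using L Nq unfolding is_limit_def by metis
  have qj: "q j \<in> Ar C" if "j \<in> Ob J" for j using q that by (auto simp: is_cone_def)
  show "\<exists>!k. k \<in> Ar C \<and> Dom C k = X \<and> Cod C k = FOb S L \<and>
      (\<forall>j\<in>Ob J. Comp C (FAr S (p j)) k = q j)"
  proof (rule ex1I)
    have "Comp C (FAr S (p j)) (FAr S h) = q j" if "j \<in> Ob J" for j
      using pj[OF that] h that qj[OF that] by (subst S_comp[symmetric]) (simp_all add: simps)
    then show "FAr S h \<in> Ar C \<and> Dom C (FAr S h) = X \<and> Cod C (FAr S h) = FOb S L \<and>
        (\<forall>j\<in>Ob J. Comp C (FAr S (p j)) (FAr S h) = q j)"
      using h XO by (simp add: simps)
  next
    fix k assume k: "k \<in> Ar C \<and> Dom C k = X \<and> Cod C k = FOb S L \<and>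
      (\<forall>j\<in>Ob J. Comp C (FAr S (p j)) k = q j)"
    have "Comp H r (FAr N k) = h"
    proof (rule uniq[OF Nq])
      show "Comp H (p j) (Comp H r (FAr N k)) = FAr N (q j)" if "j \<in> Ob J" for j
        using pj[OF that] r k that LO
        by (subst category_assoc[OF categories(2), symmetric]) (simp_all add: simps N_comp[symmetric])
    qed (use r k h in \<open>simp_all add: simps\<close>)
    moreover have "FAr S (Comp H r (FAr N k)) = k"
      using r k LO by (subst S_comp) (simp_all add: simps Sr)
    ultimately show "k = FAr S h" by simp
  qed
qed

text \<open>Left adjoints preserve colimits: maps from \<open>FOb S L\<close> to \<open>X\<close>
  correspond to maps from \<open>L\<close> to \<open>FOb N X\<close>.\<close>

lemma S_colimit:
  assumes D: "is_functor J C D" and L: "is_colimit J H (N \<circ>\<^sub>F D) L i"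
  shows "is_colimit J C D (FOb S L) (\<lambda>j. FAr S (i j))"
  unfolding is_colimit_def
proof (intro conjI allI impI)
  have i: "is_cocone J H (N \<circ>\<^sub>F D) L i" using L by (simp add: is_colimit_def)
  then have LO: "L \<in> Ob H"
    and ij: "\<And>j. j \<in> Ob J \<Longrightarrow> i j \<in> Ar H \<and> Dom H (i j) = FOb N (FOb D j) \<and> Cod H (i j) = L"
    by (auto simp: is_cocone_def fctr_comp_def)
  show "is_cocone J C D (FOb S L) (\<lambda>j. FAr S (i j))" by (rule S_cocone[OF D i])
  fix X q assume q: "is_cocone J C D X q"
  then have XO: "X \<in> Ob C" by (auto simp: is_cocone_def)
  note Nq = functor_cocone[OF D N q]
  obtain h where h: "h \<in> Ar H" "Dom H h = L" "Cod H h = FOb N X"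
      "\<And>j. j \<in> Ob J \<Longrightarrow> Comp H h (i j) = FAr N (q j)"
    and uniq: "\<And>k. k \<in> Ar H \<Longrightarrow> Dom H k = L \<Longrightarrow> Cod H k = FOb N X \<Longrightarrow>
      (\<And>j. j \<in> Ob J \<Longrightarrow> Comp H k (i j) = FAr N (q j)) \<Longrightarrow> k = h"
    using L Nq unfolding is_colimit_def by metis
  have qj: "q j \<in> Ar C" if "j \<in> Ob J" for j using q that by (auto simp: is_cocone_def)
  show "\<exists>!k. k \<in> Ar C \<and> Dom C k = FOb S L \<and> Cod C k = X \<and>
      (\<forall>j\<in>Ob J. Comp C k (FAr S (i j)) = q j)"
  proof (rule ex1I)
    have "Comp C (FAr S h) (FAr S (i j)) = q j" if "j \<in> Ob J" for j
      using ij[OF that] h that qj[OF that] by (subst S_comp[symmetric]) (simp_all add: simps)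
    then show "FAr S h \<in> Ar C \<and> Dom C (FAr S h) = FOb S L \<and> Cod C (FAr S h) = X \<and>
        (\<forall>j\<in>Ob J. Comp C (FAr S h) (FAr S (i j)) = q j)"
      using h XO by (simp add: simps)
  next
    fix k assume k: "k \<in> Ar C \<and> Dom C k = FOb S L \<and> Cod C k = X \<and>
      (\<forall>j\<in>Ob J. Comp C k (FAr S (i j)) = q j)"
    \<comment> \<open>The transpose of \<open>k\<close> mediates the cocone
      \<open>FAr N (q j)\<close>, hence is \<open>h\<close>.\<close>
    have "Comp H (FAr N k) (unit L) = h"
    proof (rule uniq)
      fix j assume j: "j \<in> Ob J"
      have "Comp H (Comp H (FAr N k) (unit L)) (i j) = Comp H (FAr N k) (Comp H (unit L) (i j))"
        using ij[OF j] k LO by (subst category_assoc[OF categories(2)]) (simp_all add: simps)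
      also have "Comp H (unit L) (i j) = FAr N (FAr S (i j))"
        using unit_natural[of "i j"] ij[OF j] functor_simps(1)[OF D j] by (simp add: simps)
      also have "Comp H (FAr N k) (FAr N (FAr S (i j))) = FAr N (q j)"
        using ij[OF j] k j by (subst N_comp[symmetric]) (simp_all add: simps)
      finally show "Comp H (Comp H (FAr N k) (unit L)) (i j) = FAr N (q j)" .
    qed (use k LO in \<open>simp_all add: simps\<close>)
    moreover have "FAr S (Comp H (FAr N k) (unit L)) = k"
      using k LO by (subst S_comp) (simp_all add: simps)
    ultimately show "k = FAr S h" by simp
  qed
qed

end

section \<open>Set theory inside the universe: unions, pairs, products and colimits of sets\<close>

section \<open>Small sets\<close>

lemma small_elts [simp]: "small (elts x)"
  by (simp add: small_def)

lemma small_subset: "small Y \<Longrightarrow> X \<subseteq> Y \<Longrightarrow> small X"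
  by (metis elts_set_of elts_separation small_def)

lemma small_image:
  fixes f :: "'u::set_universe \<Rightarrow> 'u"
  assumes "small X"
  shows "small (f ` X)"
proof -
  obtain x where "X = elts x" using assms by (auto simp: small_def)
  then show ?thesis by (simp only: small_def elts_replacement)
qed

text \<open>Replacement collects the sets \<open>set_of (F x)\<close> into one set \<open>z\<close>,
  to which the union axiom applies.\<close>

lemma small_UN:
  fixes F :: "'u::set_universe \<Rightarrow> 'u set"
  assumes "small X" "\<And>x. x \<in> X \<Longrightarrow> small (F x)"
  shows "small (\<Union>x\<in>X. F x)"
proof -
  obtain z where z: "elts z = (\<lambda>x. set_of (F x)) ` X"
    using small_image[OF assms(1)] unfolding small_def by (metis imageE)
  have "(\<Union>x\<in>X. F x) = (\<Union>y\<in>elts z. elts y)"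
    using assms(2) by (simp add: z elts_set_of)
  then show ?thesis by (simp add: small_def elts_union)
qed

lemma small_Pow: "small X \<Longrightarrow> small {y. elts y \<subseteq> X}"
  by (metis elts_power elts_set_of small_def)

text \<open>Pairing is derived: the empty set \<open>o0\<close> and its singleton \<open>o1\<close>
  are two distinct members of \<open>pow o1\<close>, and replacement maps them to \<open>a\<close>
  and \<open>b\<close>.\<close>

lemma small_doubleton: "small {a, b :: 'u::set_universe}"
proof -
  define o0 where "o0 = set_of ({} :: 'u set)"
  have "small ({} :: 'u set)" by (rule small_subset[OF small_elts]) simp
  then have o0: "elts o0 = {}" by (simp add: o0_def elts_set_of)
  define o1 where "o1 = pow o0"
  have o1: "elts o1 = {o0}" unfolding o1_def using o0 by (auto intro: elts_ext)
  have ne: "o0 \<noteq> o1" using o0 o1 by auto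
  have "{o0, o1} \<subseteq> elts (pow o1)" using o0 o1 by auto
  then have "small ((\<lambda>x. if x = o0 then a else b) ` {o0, o1})"
    by (rule small_image[OF small_subset[OF small_elts]])
  then show ?thesis using ne by (simp add: insert_commute)
qed

text \<open>Kuratowski's pair as an element of the universe, so that graphs and disjoint unions can
  be sets. Writing \<open>{a, a}\<close> lets \<open>small_doubleton\<close> apply to both
  components.\<close>

definition kpair :: "'u::set_universe \<Rightarrow> 'u \<Rightarrow> 'u" where
  "kpair a b = set_of {set_of {a, a}, set_of {a, b}}"

lemma kpair_inject [simp]: "kpair a b = kpair c d \<longleftrightarrow> a = c \<and> b = d"
proof
  assume "kpair a b = kpair c d"
  then have "{set_of {a, a}, set_of {a, b}} = {set_of {c, c}, set_of {c, d}}"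
    unfolding kpair_def by (metis elts_set_of small_doubleton)
  then have "elts ` {set_of {a, a}, set_of {a, b}} = elts ` {set_of {c, c}, set_of {c, d}}"
    by simp
  \<comment> \<open>\<open>{a, a}\<close> must not collapse before \<open>small_doubleton\<close>
    has evaluated \<open>elts\<close>.\<close>
  then have "{{a}, {a, b}} = {{c}, {c, d}}"
    by (simp add: elts_set_of small_doubleton del: insert_absorb2) simp
  then show "a = c \<and> b = d" by (auto simp: doubleton_eq_iff)
qed simp

text \<open>This is the disjoint union of the \<open>A j\<close>. Elements of a product (as graphs)
  and of a colimit (as classes) are coded as subsets of it.\<close>

lemma small_pairs:
  assumes "small I" "\<And>j. j \<in> I \<Longrightarrow> small (A j)"
  shows "small (\<Union>j\<in>I. kpair j ` A j)"
proof (rule small_UN[OF assms(1)])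
  show "small (kpair j ` A j)" if "j \<in> I" for j
    using assms(2)[OF that] by (rule small_image)
qed

text \<open>The elements are graphs of choice functions, which lie in the power set of the disjoint
  union. The statement hides this coding and keeps only projections that realize every family and
  are jointly injective.\<close>

lemma small_product_exists:
  fixes A :: "'u::set_universe \<Rightarrow> 'u set"
  assumes I: "small I" and A: "\<And>j. j \<in> I \<Longrightarrow> small (A j)"
  obtains P and pr :: "'u \<Rightarrow> 'u \<Rightarrow> 'u" where "small P"
    "\<And>j x. j \<in> I \<Longrightarrow> x \<in> P \<Longrightarrow> pr j x \<in> A j"
    "\<And>f. (\<And>j. j \<in> I \<Longrightarrow> f j \<in> A j) \<Longrightarrow> \<exists>x\<in>P. \<forall>j\<in>I. pr j x = f j"
    "\<And>x y. x \<in> P \<Longrightarrow> y \<in> P \<Longrightarrow> (\<And>j. j \<in> I \<Longrightarrow> pr j x = pr j y) \<Longrightarrow> x = y"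
proof -
  have pairs: "small (\<Union>j\<in>I. kpair j ` A j)"
    using I A by (rule small_pairs)
  \<comment> \<open>Only the values of \<open>f\<close> on \<open>I\<close> enter, whence the joint
    injectivity of the projections.\<close>
  define graph where "graph f = set_of ((\<lambda>j. kpair j (f j)) ` I)" for f
  have graph: "elts (graph f) = (\<lambda>j. kpair j (f j)) ` I" for f
    by (simp add: graph_def elts_set_of small_image I)
  define pr where "pr j x = (SOME y. kpair j y \<in> elts x)" for j x :: 'u
  have pr: "pr j (graph f) = f j" if "j \<in> I" for j f
    unfolding pr_def using that by (intro some_equality) (auto simp: graph)
  define P where "P = graph ` {f. \<forall>j\<in>I. f j \<in> A j}"
  show ?thesis
  proof
    have "P \<subseteq> {y. elts y \<subseteq> (\<Union>j\<in>I. kpair j ` A j)}"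
      unfolding P_def using graph by blast
    then show "small P"
      by (rule small_subset[OF small_Pow[OF pairs]])
    show "pr j x \<in> A j" if "j \<in> I" "x \<in> P" for j x
      using that by (auto simp: P_def pr)
    show "\<exists>x\<in>P. \<forall>j\<in>I. pr j x = f j" if "\<And>j. j \<in> I \<Longrightarrow> f j \<in> A j" for f
      using that pr unfolding P_def by blast
    show "x = y" if xy: "x \<in> P" "y \<in> P" "\<And>j. j \<in> I \<Longrightarrow> pr j x = pr j y" for x y
    proof -
      obtain f g where fg: "x = graph f" "y = graph g" using xy(1,2) unfolding P_def by blast
      then have "f j = g j" if "j \<in> I" for j using xy(3)[OF that] pr[OF that] by simp
      then show ?thesis unfolding fg graph_def by simp
    qed
  qed
qed

text \<open>
  Two elements of the disjoint union are identified in the colimit iff no predicate compatible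
  with the transition maps separates them; such predicates suffice because a compatible family \<open>g\<close>
  gives the compatible predicates \<open>g k y = z\<close>.
\<close>

lemma small_colimit_exists:
  fixes A :: "'u::set_universe \<Rightarrow> 'u set" and s t :: "'k \<Rightarrow> 'u" and m :: "'k \<Rightarrow> 'u \<Rightarrow> 'u"
  assumes I: "small I" and A: "\<And>j. j \<in> I \<Longrightarrow> small (A j)"
    and s: "\<And>u. u \<in> K \<Longrightarrow> s u \<in> I" and t: "\<And>u. u \<in> K \<Longrightarrow> t u \<in> I"
    and m: "\<And>u x. u \<in> K \<Longrightarrow> x \<in> A (s u) \<Longrightarrow> m u x \<in> A (t u)"
  obtains c :: "'u \<Rightarrow> 'u \<Rightarrow> 'u" where "small (\<Union>j\<in>I. c j ` A j)"
    "\<And>u x. u \<in> K \<Longrightarrow> x \<in> A (s u) \<Longrightarrow> c (t u) (m u x) = c (s u) x"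
    "\<And>g :: 'u \<Rightarrow> 'u \<Rightarrow> 'u. (\<And>u x. u \<in> K \<Longrightarrow> x \<in> A (s u) \<Longrightarrow> g (t u) (m u x) = g (s u) x) \<Longrightarrow>
      \<exists>h. \<forall>j\<in>I. \<forall>x\<in>A j. h (c j x) = g j x"
proof -
  have pairs: "small (\<Union>j\<in>I. kpair j ` A j)"
    using I A by (rule small_pairs)
  define compat where
    "compat P \<longleftrightarrow> (\<forall>u\<in>K. \<forall>x\<in>A (s u). P (t u) (m u x) = P (s u) x)" for P :: "'u \<Rightarrow> 'u \<Rightarrow> bool"
  \<comment> \<open>Agreement under all compatible predicates is an equivalence relation at once, so
    no zigzags of transition maps have to be generated.\<close>
  define cls where "cls j x = {kpair k y | k y. k \<in> I \<and> y \<in> A k \<and> (\<forall>P. compat P \<longrightarrow> P j x = P k y)}"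
    for j x
  have small_cls: "small (cls j x)" for j x
    by (rule small_subset[OF pairs]) (auto simp: cls_def)
  define c where "c j x = set_of (cls j x)" for j x
  show ?thesis
  proof
    show "small (\<Union>j\<in>I. c j ` A j)"
      using I A by (intro small_UN small_image)
    show "c (t u) (m u x) = c (s u) x" if "u \<in> K" "x \<in> A (s u)" for u x
    proof -
      have "P (t u) (m u x) = P (s u) x" if "compat P" for P
        using \<open>u \<in> K\<close> \<open>x \<in> A (s u)\<close> that by (auto simp: compat_def)
      then have "(\<forall>P. compat P \<longrightarrow> P (t u) (m u x) = P k y) \<longleftrightarrow> (\<forall>P. compat P \<longrightarrow> P (s u) x = P k y)" for k y
        by metis
      then show ?thesis by (simp only: c_def cls_def)
    qed
    fix g :: "'u \<Rightarrow> 'u \<Rightarrow> 'u"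
    assume g: "\<And>u x. u \<in> K \<Longrightarrow> x \<in> A (s u) \<Longrightarrow> g (t u) (m u x) = g (s u) x"
    have sep: "g j x = g k y" if jx: "j \<in> I" "x \<in> A j" and eq: "c j x = c k y" for j x k y
    proof -
      have "kpair j x \<in> cls j x" using jx by (auto simp: cls_def)
      moreover have "cls j x = cls k y"
        using eq unfolding c_def by (metis small_cls elts_set_of)
      ultimately have "kpair j x \<in> cls k y" by simp
      then have same: "P k y = P j x" if "compat P" for P
        using that unfolding cls_def by auto
      have "compat (\<lambda>l z. g l z = g j x)" using g by (simp add: compat_def)
      from same[OF this] show ?thesis by simp
    qed
    \<comment> \<open>By \<open>sep\<close> all representatives of a class give the same value;
      outside the classes \<open>h\<close> is arbitrary.\<close>
    define h where "h z = (SOME w. \<exists>j\<in>I. \<exists>x\<in>A j. c j x = z \<and> w = g j x)" for z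
    have "h (c j x) = g j x" if "j \<in> I" "x \<in> A j" for j x
      unfolding h_def by (rule some_equality) (use that sep in blast)+
    then show "\<exists>h. \<forall>j\<in>I. \<forall>x\<in>A j. h (c j x) = g j x" by blast
  qed
qed

section \<open>Limits of sets with the initial family for the projections\<close>

section \<open>Limits of set systems\<close>

lemma SSys_simps [simp]:
  "Ob SSys = {X. is_set_system X}" "Ar SSys = {g. is_ssys_mor g}" "Dom SSys = ssrc" "Cod SSys = stgt"
  "Comp SSys g f = SSysMor (ssrc f) (stgt g) (compose (elts (points (ssrc f))) (smap g) (smap f))"
  by (simp_all add: SSys_def)

lemma img_restrict: "elts A \<subseteq> V \<Longrightarrow> img (restrict f V) A = img f A"
  by (rule elts_ext) (auto simp: image_iff)

text \<open>The points are the limit of the underlying sets, cut out of the product by the arrows of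
  \<open>J\<close>. The family is initial: a function into \<open>L\<close> is a morphism as soon as
  its composites with all projections are.\<close>

lemma SSys_limit_exists:
  fixes J :: "('u::set_universe, 'k) cat" and D :: "('u, 'k, 'u set_system, 'u ssys_mor) fctr"
  assumes J: "small (Ob J)" and D: "is_functor J SSys D"
  shows "\<exists>L p. is_limit J SSys D L p"
proof -
  have Dob: "is_set_system (FOb D j)" if "j \<in> Ob J" for j
    using D that by (auto simp: is_functor_def)
  have Dar: "is_ssys_mor (FAr D u)" "ssrc (FAr D u) = FOb D (Dom J u)"
    "stgt (FAr D u) = FOb D (Cod J u)" "Dom J u \<in> Ob J" "Cod J u \<in> Ob J" if "u \<in> Ar J" for u
    using D that by (auto simp: is_functor_def is_category_def)
  obtain P and pr :: "'u \<Rightarrow> 'u \<Rightarrow> 'u" where P: "small P"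
    and pr: "\<And>j x. j \<in> Ob J \<Longrightarrow> x \<in> P \<Longrightarrow> pr j x \<in> elts (points (FOb D j))"
    and ex: "\<And>f. (\<And>j. j \<in> Ob J \<Longrightarrow> f j \<in> elts (points (FOb D j))) \<Longrightarrow> \<exists>x\<in>P. \<forall>j\<in>Ob J. pr j x = f j"
    and inj: "\<And>x y. x \<in> P \<Longrightarrow> y \<in> P \<Longrightarrow> (\<And>j. j \<in> Ob J \<Longrightarrow> pr j x = pr j y) \<Longrightarrow> x = y"
    by (rule small_product_exists[of "Ob J" "\<lambda>j. elts (points (FOb D j))"]) (use J in auto)
  define V where "V = {x\<in>P. \<forall>u\<in>Ar J. smap (FAr D u) (pr (Dom J u) x) = pr (Cod J u) x}"
  \<comment> \<open>For the empty diagram the condition is vacuous and \<open>B\<close> contains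
    every subset of \<open>V\<close>, as the terminal object requires.\<close>
  define B where "B = {A. elts A \<subseteq> V \<and> (\<forall>j\<in>Ob J. img (pr j) A \<in> elts (family (FOb D j)))}"
  have "small V" by (rule small_subset[OF P]) (auto simp: V_def)
  moreover have "small B" by (rule small_subset[OF small_Pow[OF \<open>small V\<close>]]) (auto simp: B_def)
  moreover define L where "L = SetSystem (set_of V) (set_of B)"
  ultimately have L: "elts (points L) = V" "elts (family L) = B" by (simp_all add: elts_set_of)
  have L_sys: "is_set_system L" by (auto simp: is_set_system_def L B_def)
  define p where "p j = SSysMor L (FOb D j) (restrict (pr j) V)" for j
  have p: "ssrc (p j) = L" "stgt (p j) = FOb D j" "smap (p j) = restrict (pr j) V" for j
    by (simp_all add: p_def)
  have p_mor: "is_ssys_mor (p j)" if "j \<in> Ob J" for j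
    using that Dob L_sys pr by (auto simp: is_ssys_mor_def p L V_def B_def img_restrict)
  have "is_limit J SSys D L p"
    unfolding is_limit_def
  proof (intro conjI allI impI)
    have "SSysMor L (FOb D (Cod J u)) (compose V (smap (FAr D u)) (smap (p (Dom J u)))) = p (Cod J u)"
      if "u \<in> Ar J" for u
      using that by (auto simp: p_def compose_def V_def fun_eq_iff)
    then show "is_cone J SSys D L p"
      using L_sys p_mor by (simp add: is_cone_def p Dar L)
    fix X q assume q: "is_cone J SSys D X q"
    then have X: "is_set_system X" by (simp add: is_cone_def)
    have qj: "is_ssys_mor (q j)" "ssrc (q j) = X" "stgt (q j) = FOb D j" if "j \<in> Ob J" for j
      using q that by (auto simp: is_cone_def)
    have qV: "smap (q j) \<in> elts (points X) \<rightarrow>\<^sub>E elts (points (FOb D j))"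
      and qB: "A \<in> elts (family X) \<Longrightarrow> img (smap (q j)) A \<in> elts (family (FOb D j))"
      if "j \<in> Ob J" for j A
      using qj[OF that] by (auto simp: is_ssys_mor_def)
    have qu: "smap (FAr D u) (smap (q (Dom J u)) v) = smap (q (Cod J u)) v"
      if "u \<in> Ar J" "v \<in> elts (points X)" for u v
    proof -
      have "Comp SSys (FAr D u) (q (Dom J u)) = q (Cod J u)"
        using q that(1) by (simp add: is_cone_def)
      then have "compose (elts (points X)) (smap (FAr D u)) (smap (q (Dom J u))) = smap (q (Cod J u))"
        using qj(2)[OF Dar(4)[OF that(1)]] by (metis SSys_simps(5) ssys_mor.sel(3))
      then show ?thesis using that(2) by (metis compose_eq)
    qed
    have "\<exists>x\<in>V. \<forall>j\<in>Ob J. pr j x = smap (q j) v" if v: "v \<in> elts (points X)" for v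
    proof -
      obtain x where "x \<in> P" "\<forall>j\<in>Ob J. pr j x = smap (q j) v"
        using ex[of "\<lambda>j. smap (q j) v"] qV v by (metis PiE_mem)
      then show ?thesis using qu[OF _ v] Dar(4,5) by (auto simp: V_def)
    qed
    then obtain f where f: "\<And>v. v \<in> elts (points X) \<Longrightarrow> f v \<in> V"
      "\<And>v j. v \<in> elts (points X) \<Longrightarrow> j \<in> Ob J \<Longrightarrow> pr j (f v) = smap (q j) v"
      by metis
    \<comment> \<open>Membership in \<open>B\<close> is tested through the projections, where it
      says that each \<open>q j\<close> is a morphism.\<close>
    have f_img: "img (restrict f (elts (points X))) A \<in> B" if A: "A \<in> elts (family X)" for A
    proof -
      have sub: "elts A \<subseteq> elts (points X)" using family_sub[OF X A] .
      have "img (pr j) (img f A) = img (smap (q j)) A" if "j \<in> Ob J" for j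
        using sub f(2)[OF _ that] by (intro elts_ext) (auto simp: image_image intro!: image_cong)
      then show ?thesis
        using sub f(1) qB A by (auto simp: B_def img_restrict)
    qed
    show "\<exists>!h. h \<in> Ar SSys \<and> Dom SSys h = X \<and> Cod SSys h = L \<and>
        (\<forall>j\<in>Ob J. Comp SSys (p j) h = q j)"
    proof (rule ex1I)
      let ?h = "SSysMor X L (restrict f (elts (points X)))"
      have "is_ssys_mor ?h" using X L_sys f(1) f_img by (simp add: is_ssys_mor_def L)
      moreover have "Comp SSys (p j) ?h = q j" if "j \<in> Ob J" for j
      proof (rule ssys_mor_eqI)
        \<comment> \<open>Off \<open>points X\<close> both sides are
          \<open>undefined\<close>.\<close>
        show "smap (Comp SSys (p j) ?h) = smap (q j)"
          using f that PiE_arb[OF qV[OF that]] by (simp add: p compose_def fun_eq_iff)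
      qed (simp_all add: p qj that)
      ultimately show "?h \<in> Ar SSys \<and> Dom SSys ?h = X \<and> Cod SSys ?h = L \<and>
          (\<forall>j\<in>Ob J. Comp SSys (p j) ?h = q j)" by simp
    next
      fix h assume h: "h \<in> Ar SSys \<and> Dom SSys h = X \<and> Cod SSys h = L \<and>
        (\<forall>j\<in>Ob J. Comp SSys (p j) h = q j)"
      then have "is_ssys_mor h" "ssrc h = X" "stgt h = L" by auto
      then have hV: "smap h \<in> elts (points X) \<rightarrow>\<^sub>E V"
        unfolding is_ssys_mor_def L(1)[symmetric] by metis
      have "smap h v = f v" if v: "v \<in> elts (points X)" for v
      proof (rule inj)
        show "smap h v \<in> P" "f v \<in> P" using PiE_mem[OF hV v] f(1)[OF v] by (auto simp: V_def)
        fix j assume j: "j \<in> Ob J"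
        have "smap (q j) v = smap (Comp SSys (p j) h) v" using h j by metis
        also have "\<dots> = pr j (smap h v)" using h v PiE_mem[OF hV v] by (simp add: p compose_eq)
        finally show "pr j (smap h v) = pr j (f v)" using f(2)[OF v j] by simp
      qed
      then have "smap h = restrict f (elts (points X))"
        using PiE_arb[OF hV] by (auto simp: fun_eq_iff)
      then show "h = SSysMor X L (restrict f (elts (points X)))"
        using h by (intro ssys_mor_eqI) auto
    qed
  qed
  then show ?thesis by blast
qed

section \<open>Colimits in the comma category of hypergraphs\<close>

section \<open>Colimits of hypergraphs\<close>

lemma Hyp_simps [simp]:
  "Ob Hyp = {G. is_hypergraph G}" "Ar Hyp = {f. is_hyp_mor f}" "Dom Hyp = hsrc" "Cod Hyp = htgt"
  "Comp Hyp g f = HypMor (hsrc f) (htgt g)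
    (compose (elts (edges (hsrc f))) (emap g) (emap f))
    (compose (elts (verts (hsrc f))) (vmap g) (vmap f))"
  by (simp_all add: Hyp_def)

text \<open>Colimits in a comma category are formed componentwise when the functor on the source
  side preserves them; here it is the identity on edge sets, and the incidence function is induced
  by the edge colimit. The power-set functor does not preserve limits in general, so limits are
  built among set systems instead.\<close>

lemma Hyp_colimit_exists:
  fixes J :: "('u::set_universe, 'k) cat" and D :: "('u, 'k, 'u hypergraph, 'u hyp_mor) fctr"
  assumes J: "small (Ob J)" and D: "is_functor J Hyp D"
  shows "\<exists>L i. is_colimit J Hyp D L i"
proof -
  define E where "E j = elts (edges (FOb D j))" for j
  define V where "V j = elts (verts (FOb D j))" for j
  define ep where "ep j = inc (FOb D j)" for j
  have Dob: "is_hypergraph (FOb D j)" if "j \<in> Ob J" for j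
    using D that by (auto simp: is_functor_def)
  have Dar: "is_hyp_mor (FAr D u)" "hsrc (FAr D u) = FOb D (Dom J u)"
    "htgt (FAr D u) = FOb D (Cod J u)" "Dom J u \<in> Ob J" "Cod J u \<in> Ob J" if "u \<in> Ar J" for u
    using D that by (auto simp: is_functor_def is_category_def)
  have ep: "elts (ep j e) \<subseteq> V j" if "j \<in> Ob J" "e \<in> E j" for j e
    using that inc_sub[OF Dob] by (simp add: ep_def E_def V_def)
  have De: "emap (FAr D u) e \<in> E (Cod J u)" if "u \<in> Ar J" "e \<in> E (Dom J u)" for u e
    using Dar[OF that(1)] that(2) by (auto simp: is_hyp_mor_def E_def)
  have Dv: "vmap (FAr D u) v \<in> V (Cod J u)" if "u \<in> Ar J" "v \<in> V (Dom J u)" for u v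
    using Dar[OF that(1)] that(2) by (auto simp: is_hyp_mor_def V_def)
  have Di: "ep (Cod J u) (emap (FAr D u) e) = img (vmap (FAr D u)) (ep (Dom J u) e)"
    if "u \<in> Ar J" "e \<in> E (Dom J u)" for u e
    using Dar[OF that(1)] that(2) by (auto simp: is_hyp_mor_def E_def ep_def)
  obtain ce :: "'u \<Rightarrow> 'u \<Rightarrow> 'u" where ce_small: "small (\<Union>j\<in>Ob J. ce j ` E j)"
    and ce: "\<And>u e. u \<in> Ar J \<Longrightarrow> e \<in> E (Dom J u) \<Longrightarrow> ce (Cod J u) (emap (FAr D u) e) = ce (Dom J u) e"
    and ce_univ: "\<And>g :: 'u \<Rightarrow> 'u \<Rightarrow> 'u.
      (\<And>u e. u \<in> Ar J \<Longrightarrow> e \<in> E (Dom J u) \<Longrightarrow> g (Cod J u) (emap (FAr D u) e) = g (Dom J u) e) \<Longrightarrow>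
      \<exists>h. \<forall>j\<in>Ob J. \<forall>e\<in>E j. h (ce j e) = g j e"
    by (rule small_colimit_exists[of "Ob J" E "Ar J" "Dom J" "Cod J" "\<lambda>u. emap (FAr D u)"])
      (use J Dar(4,5) De in \<open>auto simp: E_def\<close>)
  obtain cv :: "'u \<Rightarrow> 'u \<Rightarrow> 'u" where cv_small: "small (\<Union>j\<in>Ob J. cv j ` V j)"
    and cv: "\<And>u v. u \<in> Ar J \<Longrightarrow> v \<in> V (Dom J u) \<Longrightarrow> cv (Cod J u) (vmap (FAr D u) v) = cv (Dom J u) v"
    and cv_univ: "\<And>g :: 'u \<Rightarrow> 'u \<Rightarrow> 'u.
      (\<And>u v. u \<in> Ar J \<Longrightarrow> v \<in> V (Dom J u) \<Longrightarrow> g (Cod J u) (vmap (FAr D u) v) = g (Dom J u) v) \<Longrightarrow>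
      \<exists>h. \<forall>j\<in>Ob J. \<forall>v\<in>V j. h (cv j v) = g j v"
    by (rule small_colimit_exists[of "Ob J" V "Ar J" "Dom J" "Cod J" "\<lambda>u. vmap (FAr D u)"])
      (use J Dar(4,5) Dv in \<open>auto simp: V_def\<close>)
  define CE where "CE = (\<Union>j\<in>Ob J. ce j ` E j)"
  define CV where "CV = (\<Union>j\<in>Ob J. cv j ` V j)"
  \<comment> \<open>The candidate incidences agree along \<open>u\<close>: incidence commutes with
    \<open>FAr D u\<close> by \<open>Di\<close>, and \<open>cv\<close> absorbs its vertex
    map.\<close>
  have "img (cv (Cod J u)) (ep (Cod J u) (emap (FAr D u) e)) = img (cv (Dom J u)) (ep (Dom J u) e)"
    if u: "u \<in> Ar J" and e: "e \<in> E (Dom J u)" for u e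
    using cv[OF u] ep[OF Dar(4)[OF u] e] unfolding Di[OF u e]
    by (intro elts_ext) (auto simp: image_image intro!: image_cong)
  from ce_univ[of "\<lambda>j e. img (cv j) (ep j e)", OF this]
  obtain ic where ic: "\<And>j e. j \<in> Ob J \<Longrightarrow> e \<in> E j \<Longrightarrow> ic (ce j e) = img (cv j) (ep j e)"
    by blast
  define L where "L = Hypergraph (set_of CE) (restrict ic CE) (set_of CV)"
  have L: "elts (edges L) = CE" "elts (verts L) = CV" "inc L = restrict ic CE"
    using ce_small cv_small by (simp_all add: L_def elts_set_of CE_def CV_def)
  have L_hyp: "is_hypergraph L"
    using ep by (fastforce simp: is_hypergraph_def L CE_def CV_def ic)
  define i where "i j = HypMor (FOb D j) L (restrict (ce j) (E j)) (restrict (cv j) (V j))" for j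
  have i: "hsrc (i j) = FOb D j" "htgt (i j) = L" "emap (i j) = restrict (ce j) (E j)"
    "vmap (i j) = restrict (cv j) (V j)" for j
    by (simp_all add: i_def)
  have i_mor: "is_hyp_mor (i j)" if j: "j \<in> Ob J" for j
  proof -
    have "ce j e \<in> CE" if "e \<in> E j" for e using j that by (auto simp: CE_def)
    moreover have "cv j v \<in> CV" if "v \<in> V j" for v using j that by (auto simp: CV_def)
    ultimately show ?thesis
      using Dob[OF j] L_hyp ic[OF j] ep[OF j]
      by (auto simp: is_hyp_mor_def i L img_restrict simp flip: E_def V_def ep_def)
  qed
  have "is_colimit J Hyp D L i"
    unfolding is_colimit_def
  proof (intro conjI allI impI)
    have "Comp Hyp (i (Cod J u)) (FAr D u) = i (Dom J u)" if u: "u \<in> Ar J" for u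
      using De[OF u] Dv[OF u] ce[OF u] cv[OF u] Dar[OF u]
      by (intro hyp_mor_eqI) (simp_all add: i compose_def fun_eq_iff flip: E_def V_def)
    then show "is_cocone J Hyp D L i"
      using L_hyp i_mor by (simp add: is_cocone_def i)
    fix X q assume q: "is_cocone J Hyp D X q"
    then have X: "is_hypergraph X" by (simp add: is_cocone_def)
    have qj: "is_hyp_mor (q j)" "hsrc (q j) = FOb D j" "htgt (q j) = X" if "j \<in> Ob J" for j
      using q that by (auto simp: is_cocone_def)
    have qE: "emap (q j) \<in> E j \<rightarrow>\<^sub>E elts (edges X)"
      and qV: "vmap (q j) \<in> V j \<rightarrow>\<^sub>E elts (verts X)"
      and qi: "e \<in> E j \<Longrightarrow> inc X (emap (q j) e) = img (vmap (q j)) (ep j e)"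
      if "j \<in> Ob J" for j e
      using qj[OF that] by (auto simp: is_hyp_mor_def E_def V_def ep_def)
    have qu: "Comp Hyp (q (Cod J u)) (FAr D u) = q (Dom J u)" if "u \<in> Ar J" for u
      using q that by (simp add: is_cocone_def)
    have "emap (q (Cod J u)) (emap (FAr D u) e) = emap (q (Dom J u)) e"
      if "u \<in> Ar J" "e \<in> E (Dom J u)" for u e
      using that arg_cong[OF qu[OF that(1)], of "\<lambda>f. emap f e"] Dar(2)
      by (simp add: compose_eq E_def)
    from ce_univ[of "\<lambda>j. emap (q j)", OF this]
    obtain he where he: "\<And>j e. j \<in> Ob J \<Longrightarrow> e \<in> E j \<Longrightarrow> he (ce j e) = emap (q j) e"
      by blast
    have "vmap (q (Cod J u)) (vmap (FAr D u) v) = vmap (q (Dom J u)) v"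
      if "u \<in> Ar J" "v \<in> V (Dom J u)" for u v
      using that arg_cong[OF qu[OF that(1)], of "\<lambda>f. vmap f v"] Dar(2)
      by (simp add: compose_eq V_def)
    from cv_univ[of "\<lambda>j. vmap (q j)", OF this]
    obtain hv where hv: "\<And>j v. j \<in> Ob J \<Longrightarrow> v \<in> V j \<Longrightarrow> hv (cv j v) = vmap (q j) v"
      by blast
    show "\<exists>!h. h \<in> Ar Hyp \<and> Dom Hyp h = L \<and> Cod Hyp h = X \<and>
        (\<forall>j\<in>Ob J. Comp Hyp h (i j) = q j)"
    proof (rule ex1I)
      let ?h = "HypMor L X (restrict he CE) (restrict hv CV)"
      have he_X: "he e \<in> elts (edges X)" if "e \<in> CE" for e
        using that he PiE_mem[OF qE] by (auto simp: CE_def)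
      have hv_X: "hv v \<in> elts (verts X)" if "v \<in> CV" for v
        using that hv PiE_mem[OF qV] by (auto simp: CV_def)
      \<comment> \<open>On a representative \<open>d\<close>, both sides reduce to the image of
        \<open>ep j d\<close> under \<open>vmap (q j)\<close>.\<close>
      have h_inc: "inc X (he e) = img (restrict hv CV) (ic e)" if e: "e \<in> CE" for e
      proof -
        obtain j d where jd: "j \<in> Ob J" "d \<in> E j" "e = ce j d" using e by (auto simp: CE_def)
        have "elts (img (cv j) (ep j d)) \<subseteq> CV" using ep jd by (fastforce simp: CV_def)
        then have "img (restrict hv CV) (ic e) = img hv (img (cv j) (ep j d))"
          using jd ic by (simp add: img_restrict)
        also have "\<dots> = img (vmap (q j)) (ep j d)"
          using hv[OF jd(1)] ep[OF jd(1,2)]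
          by (intro elts_ext) (auto simp: image_image intro!: image_cong)
        finally show ?thesis using jd he qi by simp
      qed
      have "is_hyp_mor ?h"
        using X L_hyp he_X hv_X h_inc by (simp add: is_hyp_mor_def L)
      moreover have "Comp Hyp ?h (i j) = q j" if j: "j \<in> Ob J" for j
      proof (rule hyp_mor_eqI)
        have "ce j e \<in> CE" if "e \<in> E j" for e using j that by (auto simp: CE_def)
        then show "emap (Comp Hyp ?h (i j)) = emap (q j)"
          using he[OF j] PiE_arb[OF qE[OF j]] by (simp add: i compose_def fun_eq_iff flip: E_def)
        have "cv j v \<in> CV" if "v \<in> V j" for v using j that by (auto simp: CV_def)
        then show "vmap (Comp Hyp ?h (i j)) = vmap (q j)"
          using hv[OF j] PiE_arb[OF qV[OF j]] by (simp add: i compose_def fun_eq_iff flip: V_def)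
      qed (simp_all add: i qj j)
      ultimately show "?h \<in> Ar Hyp \<and> Dom Hyp ?h = L \<and> Cod Hyp ?h = X \<and>
          (\<forall>j\<in>Ob J. Comp Hyp ?h (i j) = q j)" by simp
    next
      fix h assume h: "h \<in> Ar Hyp \<and> Dom Hyp h = L \<and> Cod Hyp h = X \<and>
        (\<forall>j\<in>Ob J. Comp Hyp h (i j) = q j)"
      then have "is_hyp_mor h" "hsrc h = L" "htgt h = X" by auto
      then have hE: "emap h \<in> CE \<rightarrow>\<^sub>E elts (edges X)" and hV: "vmap h \<in> CV \<rightarrow>\<^sub>E elts (verts X)"
        unfolding is_hyp_mor_def L(1,2)[symmetric] by metis+
      have hi: "Comp Hyp h (i j) = q j" if "j \<in> Ob J" for j using h that by blast
      \<comment> \<open>Every edge of \<open>L\<close> has the form \<open>ce j e\<close>, so the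
        equations with the \<open>q j\<close> determine \<open>h\<close> on \<open>CE\<close>;
        vertices are treated alike.\<close>
      have "emap h (ce j e) = he (ce j e)" if "j \<in> Ob J" "e \<in> E j" for j e
        using that arg_cong[OF hi[OF that(1)], of "\<lambda>f. emap f e"] he
        by (simp add: i compose_eq flip: E_def)
      then have "emap h = restrict he CE"
        using PiE_arb[OF hE] by (fastforce simp: fun_eq_iff CE_def)
      moreover have "vmap h (cv j v) = hv (cv j v)" if "j \<in> Ob J" "v \<in> V j" for j v
        using that arg_cong[OF hi[OF that(1)], of "\<lambda>f. vmap f v"] hv
        by (simp add: i compose_eq flip: V_def)
      then have "vmap h = restrict hv CV"
        using PiE_arb[OF hV] by (fastforce simp: fun_eq_iff CV_def)
      ultimately show "h = HypMor L X (restrict he CE) (restrict hv CV)"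
        using h by (intro hyp_mor_eqI) auto
    qed
  qed
  then show ?thesis by blast
qed

section \<open>The unit of the simplification adjunction\<close>

section \<open>Set systems as a reflective subcategory of hypergraphs\<close>

text \<open>The edges of the target are the values of \<open>inc G\<close>, so the incidence
  function itself is the edge map; it merges parallel edges.\<close>

definition simplification_unit :: "'u::set_universe hypergraph \<Rightarrow> 'u hyp_mor" where
  "simplification_unit G =
    HypMor G (FOb N_H (FOb S_H G)) (inc G) (\<lambda>v\<in>elts (verts G). v)"

lemma simplification_unit_mor:
  assumes "is_hypergraph G"
  shows "is_hyp_mor (simplification_unit G)"
proof -
  have "inc G \<in> elts (edges G) \<rightarrow>\<^sub>E inc G ` elts (edges G)"
    using assms by (auto simp: is_hypergraph_def PiE_def)
  then show ?thesis
    using assms is_hypergraph_N_ob[OF is_set_system_S_ob[OF assms]]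
    by (simp add: is_hyp_mor_def simplification_unit_def N_H_def S_H_def N_ob_def img_id inc_sub)
qed

interpretation hypergraph_simplification:
  strict_reflection "SSys :: ('u::set_universe set_system, 'u ssys_mor) cat" Hyp N_H S_H
    simplification_unit
proof
  show "is_functor (SSys :: ('u set_system, 'u ssys_mor) cat) Hyp N_H" by (rule is_functor_N_H)
  show "is_functor (Hyp :: ('u hypergraph, 'u hyp_mor) cat) SSys S_H" by (rule is_functor_S_H)
  show "FOb S_H (FOb N_H X) = X" for X :: "'u set_system" by (rule S_N_ob)
  show "FAr S_H (FAr N_H f) = f" for f :: "'u ssys_mor" by (rule S_N_ar)
  fix G :: "'u hypergraph" assume "G \<in> Ob Hyp"
  then have G: "is_hypergraph G" by simp
  show "simplification_unit G \<in> Ar Hyp" using simplification_unit_mor[OF G] by simp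
  show "Dom Hyp (simplification_unit G) = G"
    "Cod Hyp (simplification_unit G) = FOb N_H (FOb S_H G)"
    by (simp_all add: simplification_unit_def)
  show "FAr S_H (simplification_unit G) = Id SSys (FOb S_H G)"
    by (simp add: simplification_unit_def S_H_def SSys_def N_H_def)
      (simp add: N_ob_def S_ob_def)
next
  fix g :: "'u hyp_mor" assume "g \<in> Ar Hyp"
  then have g: "is_hypergraph (hsrc g)" "emap g \<in> elts (edges (hsrc g)) \<rightarrow>\<^sub>E elts (edges (htgt g))"
    "vmap g \<in> elts (verts (hsrc g)) \<rightarrow>\<^sub>E elts (verts (htgt g))"
    "\<And>e. e \<in> elts (edges (hsrc g)) \<Longrightarrow> inc (htgt g) (emap g e) = img (vmap g) (inc (hsrc g) e)"
    by (auto simp: is_hyp_mor_def)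
  \<comment> \<open>On edges this is the incidence equation of a morphism; on vertices both sides
    are \<open>vmap g\<close>.\<close>
  show "Comp Hyp (simplification_unit (Cod Hyp g)) g =
      Comp Hyp (FAr N_H (FAr S_H g)) (simplification_unit (Dom Hyp g))"
    by (intro hyp_mor_eqI)
      (simp_all add: simplification_unit_def N_H_def S_H_def N_ob_def
        compose_id_left[OF g(3)] compose_id_right[OF g(3)], auto simp: compose_def fun_eq_iff g(4))
next
  fix X :: "'u set_system"
  show "simplification_unit (FOb N_H X) = Id Hyp (FOb N_H X)"
    by (simp add: simplification_unit_def S_N_ob Hyp_def) (simp add: N_H_def N_ob_def)
qed

text \<open>The existence clauses in \<open>Hyp\<close> keep the transfer clauses from being
  vacuous; the latter hold for every limit and colimit, not only for the constructed ones.\<close>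

theorem mainTheorem9:
  shows "complete TYPE('u::set_universe) (SSys :: ('u set_system, 'u ssys_mor) cat) \<and>
    cocomplete TYPE('u) (SSys :: ('u set_system, 'u ssys_mor) cat) \<and>
    (\<forall>(J :: ('u, 'u) cat) (D :: ('u, 'u, 'u set_system, 'u ssys_mor) fctr).
       small_category J \<and> is_functor J SSys D \<longrightarrow>
         (\<exists>L p. is_limit J Hyp (N_H \<circ>\<^sub>F D) L p) \<and>
         (\<forall>L p. is_limit J Hyp (N_H \<circ>\<^sub>F D) L p \<longrightarrow>
            is_limit J SSys D (FOb S_H L) (\<lambda>j. FAr S_H (p j))) \<and>
         (\<exists>L i. is_colimit J Hyp (N_H \<circ>\<^sub>F D) L i) \<and>
         (\<forall>L i. is_colimit J Hyp (N_H \<circ>\<^sub>F D) L i \<longrightarrow>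
            is_colimit J SSys D (FOb S_H L) (\<lambda>j. FAr S_H (i j))))"
proof -
  \<comment> \<open>The constructions start on opposite sides: limits pass from \<open>SSys\<close>
    to \<open>Hyp\<close> by \<open>N_limit\<close>, colimits from \<open>Hyp\<close> to
    \<open>SSys\<close> by \<open>S_colimit\<close>.\<close>
  have lim: "\<exists>L p. is_limit J SSys D L p" and colim: "\<exists>L i. is_colimit J Hyp (N_H \<circ>\<^sub>F D) L i"
    if "small_category J" "is_functor J SSys D"
    for J :: "('u, 'u) cat" and D :: "('u, 'u, 'u set_system, 'u ssys_mor) fctr"
    using that SSys_limit_exists Hyp_colimit_exists functor_comp[OF _ is_functor_N_H]
    unfolding small_category_def by blast+
  note reflect = hypergraph_simplification.N_limit hypergraph_simplification.S_limit
    hypergraph_simplification.S_colimit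
  show ?thesis
    unfolding complete_def cocomplete_def
    by (intro conjI allI impI; elim conjE) (blast intro: reflect dest: lim colim)+
qed

end
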